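(* Let $(\Gamma,\cdot)$ be a finite group of odd order. If $D$ is a complete digraph on $|\Gamma|+1$ vertices, then for any $\Gamma$-labelling of $D$, there is a balanced cycle.
   Context: A complete digraph is a digraph having both arcs $(x,y)$ and $(y,x)$ for any two distinct vertices $x,y$ (exactly one arc for each ordered pair of distinct vertices, and no loops). For a group $(\Gamma,\cdot)$ (not necessarily Abelian), a $\Gamma$-labelling of a digraph $D$ is a map from the set $A(D)$ of arcs of $D$ to $\Gamma$. A directed cycle has pairwise distinct vertices and length at least $2$ (directed cycles of length $2$ are allowed). A balanced cycle is a directed cycle for which the cumulative product of its arc-labels, taken in order along the cycle, equals the identity of $\Gamma$; this does not depend on which vertex of the cycle is taken as the starting point. *)

theory Defs
  imports "HOL-Algebra.Coset" "Graph_Theory.Kuratowski"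
begin

definition labelling ::
  "('g, 'm) monoid_scheme \<Rightarrow> ('v, 'e) pre_digraph \<Rightarrow> ('e \<Rightarrow> 'g) set" where
  "labelling \<Gamma> D = arcs D \<rightarrow> carrier \<Gamma>"

definition label_product ::
  "('g, 'm) monoid_scheme \<Rightarrow> ('e \<Rightarrow> 'g) \<Rightarrow> 'e list \<Rightarrow> 'g" where
  "label_product \<Gamma> l p = foldr (\<otimes>\<^bsub>\<Gamma>\<^esub>) (map l p) \<one>\<^bsub>\<Gamma>\<^esub>"

text \<open>
  A cycle is given by the list of its arcs in order, so a starting vertex is chosen; rotating the
  list conjugates the product of the labels, so whether it is the identity does not depend on the
  choice. The library's \<^const>\<open>pre_digraph.cycle\<close> admits loops, which the bound on the
  length excludes; cycles of length two are allowed.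
\<close>
definition balanced_cycle ::
  "('g, 'm) monoid_scheme \<Rightarrow> ('v, 'e) pre_digraph \<Rightarrow> ('e \<Rightarrow> 'g) \<Rightarrow> 'e list \<Rightarrow> bool" where
  "balanced_cycle \<Gamma> D l p \<longleftrightarrow>
     pre_digraph.cycle D p \<and> length p \<ge> 2 \<and> label_product \<Gamma> l p = \<one>\<^bsub>\<Gamma>\<^esub>"

end

theory Submission
  imports Defs
begin

text \<open>
  Suppose that no cycle is balanced. For a set \<open>T\<close> of vertices with closing weights \<open>s\<close>, let \<open>P y\<close> be
  the set of all products of the labels along a path inside \<open>T\<close> from \<open>y\<close> to some vertex \<open>v\<close>,
  multiplied by \<open>s v\<close>. By induction on \<open>T\<close>, some \<open>P y\<close> has at least \<open>card T\<close> elements; taking for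
  \<open>T\<close> all vertices but \<open>r\<close>, and for \<open>s v\<close> the label of the arc from \<open>v\<close> to \<open>r\<close>, this produces
  every element of \<open>\<Gamma>\<close> as the weight of a cycle through \<open>r\<close>.

  In the induction step, if all \<open>P y\<close> are too small then all have \<open>card T - 1\<close> elements, the
  translate \<open>w y v <# P v\<close> differs from \<open>P y\<close> in at most one element, and every \<open>y\<close> has some \<open>v\<close> for
  which the two sets agree. Following these \<open>v\<close> around a cycle yields a nontrivial stabilizer of
  every \<open>P y\<close>. In a group of odd order, two sets with nontrivial stabilizers cannot differ by the
  exchange of a single element, so \<open>w y v <# P v = P y\<close> throughout, and all cycles through a vertex
  \<open>r\<close> have weights that stabilize \<open>P r\<close>. By induction there are \<open>card T - 1\<close> such weights, which is
  the cardinality of \<open>P r\<close>, so one of them is the identity.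
\<close>

no_notation (ASCII) subset_mset (infix \<open><#\<close> 50)

section \<open>Stabilizers of sets in groups of odd order\<close>

text \<open>A family instead of one set, because the argument uses both the stabilizer of a single
  set and the common stabilizer of all even sets.\<close>

definition set_stabilizer :: "('g, 'm) monoid_scheme \<Rightarrow> 'g set set \<Rightarrow> 'g set" where
  "set_stabilizer G F = {k \<in> carrier G. \<forall>A \<in> F. k <#\<^bsub>G\<^esub> A = A}"

text \<open>For a subgroup \<open>K\<close> these are exactly the unions of right cosets of
  \<open>K\<close>.\<close>

definition left_invariant_sets :: "('g, 'm) monoid_scheme \<Rightarrow> 'g set \<Rightarrow> 'g set set" where
  "left_invariant_sets G K = {A. A \<subseteq> carrier G \<and> (\<forall>k \<in> K. \<forall>x \<in> A. k \<otimes>\<^bsub>G\<^esub> x \<in> A)}"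

text \<open>The parity pattern of \<open>A\<close> on the right cosets of a subgroup
  \<open>K\<close>, stored as a union of cosets. Patterns are then themselves invariant sets and are
  counted as such.\<close>

definition odd_cosets :: "('g, 'm) monoid_scheme \<Rightarrow> 'g set \<Rightarrow> 'g set \<Rightarrow> 'g set" where
  "odd_cosets G K A = {x \<in> carrier G. odd (card (A \<inter> (K #>\<^bsub>G\<^esub> x)))}"

lemma odd_card_sym_diff:
  assumes "finite A" "finite B"
  shows "odd (card (sym_diff A B)) \<longleftrightarrow> odd (card A) \<noteq> odd (card B)"
proof -
  have "card (sym_diff A B) = card (A - B) + card (B - A)"
    using assms by (intro card_Un_disjoint) auto
  moreover have "card A = card (A - B) + card (A \<inter> B)"
    using assms by (metis Int_Diff_disjoint Int_Diff_Un add.commute card_Un_disjoint finite_Diff finite_Int)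
  moreover have "card B = card (B - A) + card (A \<inter> B)"
    using assms by (metis Int_Diff_disjoint Int_Diff_Un Int_commute add.commute card_Un_disjoint finite_Diff finite_Int)
  ultimately show ?thesis
    by presburger
qed

context group
begin

lemma card_l_coset_eq:
  assumes "A \<subseteq> carrier G" "g \<in> carrier G"
  shows "card (g <# A) = card A"
proof -
  have "g <# A = (\<lambda>x. g \<otimes> x) ` A"
    by (auto simp: l_coset_def)
  moreover have "inj_on (\<lambda>x. g \<otimes> x) A"
    using assms by (auto simp: inj_on_def subset_iff)
  ultimately show ?thesis
    by (simp add: card_image)
qed

lemma subgroup_set_stabilizer:
  assumes "F \<subseteq> Pow (carrier G)"
  shows "subgroup (set_stabilizer G F) G"
proof (unfold_locales)
  show "set_stabilizer G F \<subseteq> carrier G"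
    by (auto simp: set_stabilizer_def)
  show "\<one> \<in> set_stabilizer G F"
    using assms by (auto simp: set_stabilizer_def lcos_mult_one subset_iff)
  fix x assume x: "x \<in> set_stabilizer G F"
  have "inv x <# A = A" if "A \<in> F" for A
  proof -
    have "x <# A = A" "A \<subseteq> carrier G" "x \<in> carrier G"
      using x that assms by (auto simp: set_stabilizer_def)
    then show ?thesis
      using lcos_m_assoc[of A "inv x" x] lcos_mult_one[of A] by simp
  qed
  then show "inv x \<in> set_stabilizer G F"
    using x by (auto simp: set_stabilizer_def)
  fix y assume y: "y \<in> set_stabilizer G F"
  have "x \<otimes> y <# A = A" if "A \<in> F" for A
  proof -
    have "x <# A = A" "y <# A = A" "A \<subseteq> carrier G" "x \<in> carrier G" "y \<in> carrier G"
      using x y that assms by (auto simp: set_stabilizer_def)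
    then show ?thesis
      using lcos_m_assoc[of A x y] by simp
  qed
  then show "x \<otimes> y \<in> set_stabilizer G F"
    using x y by (auto simp: set_stabilizer_def)
qed

lemma set_stabilizer_invariant:
  assumes "F \<subseteq> Pow (carrier G)" "A \<in> F"
  shows "A \<in> left_invariant_sets G (set_stabilizer G F)"
  using assms by (fastforce simp: left_invariant_sets_def set_stabilizer_def l_coset_def)

section \<open>Counting invariant sets and parity patterns\<close>

lemma finite_left_invariant_sets:
  assumes "finite (carrier G)"
  shows "finite (left_invariant_sets G K)"
  by (rule finite_subset[of _ "Pow (carrier G)"]) (use assms in \<open>auto simp: left_invariant_sets_def\<close>)

lemma left_invariant_set_eq_Union_rcosets:
  assumes K: "subgroup K G" and A: "A \<in> left_invariant_sets G K"
  shows "A = \<Union>((\<lambda>x. K #> x) ` A)"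
proof
  have "A \<subseteq> carrier G"
    using A by (simp add: left_invariant_sets_def)
  then show "A \<subseteq> \<Union>((\<lambda>x. K #> x) ` A)"
    using rcos_self[OF _ K] by blast
  show "\<Union>((\<lambda>x. K #> x) ` A) \<subseteq> A"
    using A by (auto simp: left_invariant_sets_def r_coset_def)
qed

text \<open>An invariant set is determined by the cosets of which it is the union.\<close>

lemma card_left_invariant_sets_le:
  assumes fin: "finite (carrier G)" and K: "subgroup K G"
  shows "card (left_invariant_sets G K) \<le> 2 ^ card (rcosets K)"
proof -
  have "inj_on (\<lambda>A. (\<lambda>x. K #> x) ` A) (left_invariant_sets G K)"
    by (rule inj_onI) (metis left_invariant_set_eq_Union_rcosets[OF K])
  moreover have "(\<lambda>A. (\<lambda>x. K #> x) ` A) ` left_invariant_sets G K \<subseteq> Pow (rcosets K)"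
    by (auto simp: left_invariant_sets_def RCOSETS_def)
  moreover have finR: "finite (rcosets K)"
    using fin by (simp add: RCOSETS_def)
  ultimately have "card (left_invariant_sets G K) \<le> card (Pow (rcosets K))"
    by (intro card_inj_on_le) auto
  then show ?thesis
    using finR by (simp add: card_Pow)
qed

lemma odd_cosets_invariant:
  assumes K: "subgroup K G"
  shows "odd_cosets G K A \<in> left_invariant_sets G K"
proof -
  have "K #> (k \<otimes> x) = K #> x" if "k \<in> K" "x \<in> carrier G" for k x
    using that K coset_mult_assoc[of K k x] subgroup.rcos_const[OF K is_group, of k]
      subgroup.subset[OF K] by auto
  then show ?thesis
    using subgroup.subset[OF K] by (auto simp: left_invariant_sets_def odd_cosets_def)
qed

lemma odd_cosets_sym_diff:
  assumes "finite A" "finite B"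
  shows "odd_cosets G K (sym_diff A B) = sym_diff (odd_cosets G K A) (odd_cosets G K B)"
proof -
  have "sym_diff A B \<inter> (K #> x) = sym_diff (A \<inter> (K #> x)) (B \<inter> (K #> x))" for x
    by blast
  then show ?thesis
    using assms by (auto simp: odd_cosets_def odd_card_sym_diff)
qed

text \<open>\<open>A\<close> is a disjoint union of right cosets of \<open>K\<close>, and
  \<open>E\<close> meets each of them in an even number of elements.\<close>

lemma even_card_Int_invariant:
  assumes fin: "finite (carrier G)" and K: "subgroup K G"
    and A: "A \<in> left_invariant_sets G K" and E: "odd_cosets G K E = {}"
  shows "even (card (E \<inter> A))"
proof -
  have AG: "A \<subseteq> carrier G" and finA: "finite A"
    using A fin by (auto simp: left_invariant_sets_def intro: finite_subset)
  let ?C = "(\<lambda>c. E \<inter> c) ` (\<lambda>x. K #> x) ` A"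
  have eq: "E \<inter> A = \<Union>?C"
    using left_invariant_set_eq_Union_rcosets[OF K A] by blast
  have "2 dvd card (\<Union>?C)"
  proof (rule dvd_partition)
    show "finite (\<Union>?C)"
      using finA eq by (metis finite_Int)
    show "\<forall>c\<in>?C. 2 dvd card c"
      using E AG by (auto simp: odd_cosets_def)
    show "\<forall>c1\<in>?C. \<forall>c2\<in>?C. c1 \<noteq> c2 \<longrightarrow> c1 \<inter> c2 = {}"
    proof (intro ballI impI)
      fix c1 c2 assume c: "c1 \<in> ?C" "c2 \<in> ?C" "c1 \<noteq> c2"
      then obtain x y where xy: "x \<in> A" "y \<in> A" "c1 = E \<inter> (K #> x)" "c2 = E \<inter> (K #> y)"
        by auto
      then have "(K #> x) \<inter> (K #> y) = {}"
        using c rcos_disjoint[OF K] AG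
        by (auto simp: pairwise_def disjnt_def RCOSETS_def)
      then show "c1 \<inter> c2 = {}"
        using xy by blast
    qed
  qed
  then show ?thesis
    using eq by simp
qed

text \<open>By Lagrange, a subgroup of order two would make the group order even.\<close>

lemma card_subgroup_ge_3:
  assumes fin: "finite (carrier G)" and odd: "odd (order G)"
    and K: "subgroup K G" and k: "k \<in> K" "k \<noteq> \<one>"
  shows "card K \<ge> 3"
proof -
  have "finite K"
    using subgroup.subset[OF K] fin finite_subset by blast
  moreover have "{\<one>, k} \<subseteq> K"
    using k subgroup.one_closed[OF K] by simp
  ultimately have "card {\<one>, k} \<le> card K"
    by (rule card_mono)
  then have "2 \<le> card K"
    using k by simp
  moreover have "card K \<noteq> 2"
    using odd lagrange[OF K] by (metis dvd_triv_right)
  ultimately show ?thesis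
    by simp
qed

text \<open>
  Call \<open>E\<close> even if it meets all right cosets of the stabilizers of \<open>A\<close> and of \<open>B\<close> in an even number
  of elements. An even set contains both or neither of \<open>a\<close> and \<open>b\<close>; as right translates of even
  sets are even, all even sets are invariant under left multiplication by \<open>b \<otimes> inv a\<close>. Nontrivial
  subgroups have at least three elements, so fewer than \<open>2 ^ (n / 3)\<close> sets are even, where
  \<open>n = order G\<close>; but the even sets are the kernel of a map from \<open>2 ^ n\<close> sets into at most
  \<open>2 ^ (n / 3) * 2 ^ (n / 3)\<close> parity patterns.
\<close>
lemma not_single_exchange:
  assumes fin: "finite (carrier G)" and odd: "odd (order G)"
    and A: "A \<subseteq> carrier G" and B: "B \<subseteq> carrier G"
    and h: "h \<in> carrier G" "h \<noteq> \<one>" "h <# A = A"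
    and m: "m \<in> carrier G" "m \<noteq> \<one>" "m <# B = B"
    and a: "A - B = {a}" and b: "B - A = {b}"
  shows False
proof -
  define H M where "H = set_stabilizer G {A}" and "M = set_stabilizer G {B}"
  define \<E> where "\<E> = {E \<in> Pow (carrier G). odd_cosets G H E = {} \<and> odd_cosets G M E = {}}"
  define K where "K = set_stabilizer G \<E>"
  have \<E>: "\<E> \<subseteq> Pow (carrier G)"
    by (auto simp: \<E>_def)
  have sub: "subgroup H G" "subgroup M G" "subgroup K G"
    using A B \<E> by (auto simp: H_def M_def K_def intro!: subgroup_set_stabilizer)
  have ab: "a \<in> carrier G" "b \<in> carrier G" "a \<noteq> b"
    using A B a b by auto
  have fins: "finite A" "finite B"
    using A B fin finite_subset by auto
  \<comment> \<open>An even set meets the invariant sets \<open>A\<close> and \<open>B\<close>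
    evenly, hence also their symmetric difference \<open>{a, b}\<close>.\<close>
  have swap: "a \<in> E \<longleftrightarrow> b \<in> E" if "E \<in> \<E>" for E
  proof -
    have "A \<in> left_invariant_sets G H" "B \<in> left_invariant_sets G M"
      using A B by (auto simp: H_def M_def intro: set_stabilizer_invariant)
    then have "even (card (E \<inter> A))" "even (card (E \<inter> B))"
      using that even_card_Int_invariant[OF fin] sub by (auto simp: \<E>_def)
    then have "even (card (sym_diff (E \<inter> A) (E \<inter> B)))"
      using fins odd_card_sym_diff[of "E \<inter> A" "E \<inter> B"] by auto
    moreover have "sym_diff (E \<inter> A) (E \<inter> B) = E \<inter> {a, b}"
      using a b by blast
    ultimately have "even (card (E \<inter> {a, b}))"
      by simp
    moreover have "card (E \<inter> {a, b}) = 1" if "(a \<in> E) \<noteq> (b \<in> E)"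
    proof -
      have "E \<inter> {a, b} = {a} \<or> E \<inter> {a, b} = {b}"
        using that by blast
      then show ?thesis
        by auto
    qed
    ultimately show ?thesis
      by fastforce
  qed
  have rinv: "E #> g \<in> \<E>" if E: "E \<in> \<E>" and g: "g \<in> carrier G" for E g
  proof -
    have EG: "E \<subseteq> carrier G"
      using E \<E> by auto
    have "odd_cosets G L (E #> g) = {}" if L: "subgroup L G" "odd_cosets G L E = {}" for L
    proof -
      have "even (card ((E #> g) \<inter> (L #> x)))" if x: "x \<in> carrier G" for x
      proof -
        have inj: "inj_on (\<lambda>y. y \<otimes> g) (carrier G)"
          using g by (simp add: inj_on_def)
        have r: "X #> g = (\<lambda>y. y \<otimes> g) ` X" for X
          by (auto simp: r_coset_def)
        have LG: "L \<subseteq> carrier G"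
          using L subgroup.subset by blast
        \<comment> \<open>Translating back by \<open>inv g\<close> replaces the coset by another
          right coset of the same \<open>L\<close>.\<close>
        have "L #> x = (L #> (x \<otimes> inv g)) #> g"
          using LG x g by (simp add: coset_mult_assoc m_assoc)
        then have "(E #> g) \<inter> (L #> x) = (E \<inter> (L #> (x \<otimes> inv g))) #> g"
          using inj_on_image_Int[OF inj EG, of "L #> (x \<otimes> inv g)"] r_coset_subset_G[OF LG, of "x \<otimes> inv g"] x g
          by (simp add: r)
        also have "card \<dots> = card (E \<inter> (L #> (x \<otimes> inv g)))"
          unfolding r by (rule card_image) (rule inj_on_subset[OF inj], use EG in auto)
        finally show ?thesis
          using L x g by (auto simp: odd_cosets_def)
      qed
      then show ?thesis
        by (simp add: odd_cosets_def)
    qed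
    then show ?thesis
      using E sub r_coset_subset_G[OF EG g] by (auto simp: \<E>_def)
  qed
  define c where "c = b \<otimes> inv a"
  have c: "c \<in> carrier G" "c \<noteq> \<one>"
    using ab by (auto simp: c_def inv_eq_1_iff inv_solve_right')
  have "c \<in> K"
  proof -
    have "c <# E = E" if E: "E \<in> \<E>" for E
    proof (rule card_subset_eq)
      have EG: "E \<subseteq> carrier G"
        using E \<E> by auto
      then show "finite E"
        using fin finite_subset by blast
      show "c <# E \<subseteq> E"
      proof
        fix y assume "y \<in> c <# E"
        then obtain x where x: "x \<in> E" "y = c \<otimes> x"
          by (auto simp: l_coset_def)
        have xG: "x \<in> carrier G"
          using x EG by auto
        \<comment> \<open>Right translation by \<open>g\<close> carries \<open>x\<close> to
          \<open>a\<close>. The swap then puts \<open>b\<close> into \<open>E #> g\<close>, and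
          undoing the translation puts \<open>c \<otimes> x\<close> into \<open>E\<close>.\<close>
        define g where "g = inv x \<otimes> a"
        have g: "g \<in> carrier G"
          using xG ab by (simp add: g_def)
        have "a = x \<otimes> g"
          using xG ab by (simp add: g_def m_assoc[symmetric])
        then have "a \<in> E #> g"
          using x by (auto simp: r_coset_def)
        then have "b \<in> E #> g"
          using swap[OF rinv[OF E g]] by simp
        then obtain z where z: "z \<in> E" "b = z \<otimes> g"
          by (auto simp: r_coset_def)
        then have "z \<in> carrier G"
          using EG by auto
        then have "z = b \<otimes> inv g"
          using z g by (simp add: m_assoc)
        also have "\<dots> = y"
          using x xG ab by (simp add: g_def c_def inv_mult_group m_assoc)
        finally show "y \<in> E"
          using z by simp
      qed
      show "card (c <# E) = card E"
        using EG c by (simp add: card_l_coset_eq)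
    qed
    then show ?thesis
      using c by (simp add: K_def set_stabilizer_def)
  qed
  have "h \<in> H" "m \<in> M"
    using h m by (auto simp: H_def M_def set_stabilizer_def)
  then have big: "card H \<ge> 3" "card M \<ge> 3" "card K \<ge> 3"
    using sub h m c \<open>c \<in> K\<close> card_subgroup_ge_3[OF fin odd] by blast+
  have third: "3 * card (rcosets L) \<le> order G" if "subgroup L G" "card L \<ge> 3" for L
  proof -
    have "card (rcosets L) * 3 \<le> card (rcosets L) * card L"
      using that(2) by simp
    then show ?thesis
      using lagrange[OF that(1)] by simp
  qed
  define \<pi> where "\<pi> = (\<lambda>E. (odd_cosets G H E, odd_cosets G M E))"
  define Y where "Y = left_invariant_sets G H \<times> left_invariant_sets G M"
  have finY: "finite Y"
    using finite_left_invariant_sets[OF fin] by (simp add: Y_def)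
  \<comment> \<open>The whole group meets the coset \<open>H\<close> in \<open>card H\<close>, an
    odd number of elements. As it is \<open>K\<close>-invariant, the bound on
    \<open>card \<E>\<close> becomes strict, which decides the final count.\<close>
  have "carrier G \<notin> \<E>"
  proof
    assume "carrier G \<in> \<E>"
    then have "even (card (carrier G \<inter> (H #> \<one>)))"
      by (auto simp: \<E>_def odd_cosets_def)
    moreover have "carrier G \<inter> (H #> \<one>) = H"
      using subgroup.subset[OF sub(1)] by auto
    ultimately show False
      using odd lagrange[OF sub(1)] by (metis dvd_mult)
  qed
  moreover have "carrier G \<in> left_invariant_sets G K"
    using subgroup.subset[OF sub(3)] by (auto simp: left_invariant_sets_def)
  moreover have "\<E> \<subseteq> left_invariant_sets G K"
    using set_stabilizer_invariant[OF \<E>] by (auto simp: K_def)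
  ultimately have "\<E> \<subset> left_invariant_sets G K"
    by blast
  then have lt: "card \<E> < 2 ^ card (rcosets K)"
    using less_le_trans[OF psubset_card_mono card_left_invariant_sets_le[OF fin sub(3)]]
      finite_left_invariant_sets[OF fin] by blast
  \<comment> \<open>Symmetric difference with a fixed member \<open>E0\<close> maps a fiber of
    \<open>\<pi>\<close> injectively into the kernel \<open>\<E>\<close>.\<close>
  have fiber: "card {E \<in> Pow (carrier G). \<pi> E = p} \<le> card \<E>" for p
  proof (cases "{E \<in> Pow (carrier G). \<pi> E = p} = {}")
    case False
    then obtain E0 where E0: "E0 \<subseteq> carrier G" "\<pi> E0 = p"
      by auto
    show ?thesis
    proof (rule card_inj_on_le)
      show "inj_on (\<lambda>E. sym_diff E E0) {E \<in> Pow (carrier G). \<pi> E = p}"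
        by (rule inj_onI) blast
      show "finite \<E>"
        using \<E> fin by (simp add: finite_subset)
      show "(\<lambda>E. sym_diff E E0) ` {E \<in> Pow (carrier G). \<pi> E = p} \<subseteq> \<E>"
      proof
        fix F assume "F \<in> (\<lambda>E. sym_diff E E0) ` {E \<in> Pow (carrier G). \<pi> E = p}"
        then obtain E where E: "E \<subseteq> carrier G" "\<pi> E = \<pi> E0" "F = sym_diff E E0"
          using E0 by auto
        moreover have "finite E" "finite E0"
          using E(1) E0(1) fin finite_subset by auto
        ultimately show "F \<in> \<E>"
          using E0 by (auto simp: \<E>_def \<pi>_def odd_cosets_sym_diff)
      qed
    qed
  next
    case True
    show ?thesis
      unfolding True by simp
  qed
  have "Pow (carrier G) \<subseteq> (\<Union>p\<in>Y. {E \<in> Pow (carrier G). \<pi> E = p})"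
    using odd_cosets_invariant sub by (auto simp: Y_def \<pi>_def)
  then have "card (Pow (carrier G)) \<le> card (\<Union>p\<in>Y. {E \<in> Pow (carrier G). \<pi> E = p})"
    using fin by (intro card_mono finite_subset[of "\<Union>p\<in>Y. {E \<in> Pow (carrier G). \<pi> E = p}" "Pow (carrier G)"]) auto
  also have "\<dots> \<le> (\<Sum>p\<in>Y. card {E \<in> Pow (carrier G). \<pi> E = p})"
    by (rule card_UN_le[OF finY])
  also have "\<dots> \<le> card Y * card \<E>"
    using sum_bounded_above[of Y _ "card \<E>", OF fiber] by simp
  finally have "2 ^ order G \<le> card Y * card \<E>"
    using fin by (simp add: card_Pow order_def)
  also have "card Y \<le> 2 ^ card (rcosets H) * 2 ^ card (rcosets M)"
    unfolding Y_def card_cartesian_product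
    by (intro mult_le_mono card_left_invariant_sets_le[OF fin] sub)
  then have "card Y * card \<E> \<le> 2 ^ card (rcosets H) * 2 ^ card (rcosets M) * card \<E>"
    by simp
  also have "\<dots> < 2 ^ card (rcosets H) * 2 ^ card (rcosets M) * 2 ^ card (rcosets K)"
    using lt by simp
  also have "\<dots> = 2 ^ (card (rcosets H) + card (rcosets M) + card (rcosets K))"
    by (simp add: power_add)
  also have "\<dots> \<le> 2 ^ order G"
    using third[OF sub(1) big(1)] third[OF sub(2) big(2)] third[OF sub(3) big(3)]
    by (intro power_increasing) auto
  finally show False
    by simp
qed

end

section \<open>Path weights\<close>

fun walk_weight :: "('g, 'm) monoid_scheme \<Rightarrow> ('v \<Rightarrow> 'v \<Rightarrow> 'g) \<Rightarrow> 'v list \<Rightarrow> 'g" where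
  "walk_weight G w [] = \<one>\<^bsub>G\<^esub>"
| "walk_weight G w [v] = \<one>\<^bsub>G\<^esub>"
| "walk_weight G w (u # v # vs) = w u v \<otimes>\<^bsub>G\<^esub> walk_weight G w (v # vs)"

text \<open>The closing weight \<open>s\<close> need not come from \<open>w\<close>: it may be
  arbitrary, or the label of an arc back to a deleted vertex.\<close>

definition path_weights ::
  "('g, 'm) monoid_scheme \<Rightarrow> ('v \<Rightarrow> 'v \<Rightarrow> 'g) \<Rightarrow> 'v set \<Rightarrow> ('v \<Rightarrow> 'g) \<Rightarrow> 'v \<Rightarrow> 'g set" where
  "path_weights G w T s y =
     {walk_weight G w vs \<otimes>\<^bsub>G\<^esub> s (last vs) | vs. vs \<noteq> [] \<and> hd vs = y \<and> distinct vs \<and> set vs \<subseteq> T}"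

text \<open>The orbit of \<open>x\<^sub>0\<close> must repeat. Taking the least return time over all
  points of the orbit makes the iterates within one period distinct, as a collision would give a
  shorter return.\<close>

lemma funpow_cycle:
  assumes "finite N" "x\<^sub>0 \<in> N" "\<phi> ` N \<subseteq> N"
  obtains x n where "x \<in> N" "0 < n" "(\<phi> ^^ n) x = x" "inj_on (\<lambda>i. (\<phi> ^^ i) x) {..<n}"
proof -
  define f where "f = (\<lambda>i. (\<phi> ^^ i) x\<^sub>0)"
  have f_add: "(\<phi> ^^ m) (f i) = f (i + m)" for i m
    by (metis add.commute comp_apply f_def funpow_add)
  have fN: "f i \<in> N" for i
    by (induct i) (use assms in \<open>auto simp: f_def\<close>)
  have "finite (range f)"
    using fN assms(1) by (auto intro: finite_subset)
  then have "\<not> inj f"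
    using finite_imageD infinite_UNIV_nat by blast
  then obtain i j where "i < j" "f i = f j"
    by (auto simp: inj_on_def) (metis nat_neq_iff)
  then have ex: "0 < j - i \<and> (\<exists>k. f (k + (j - i)) = f k)"
    by (auto intro!: exI[of _ i])
  define n where "n = (LEAST n. 0 < n \<and> (\<exists>k. f (k + n) = f k))"
  have n: "0 < n \<and> (\<exists>k. f (k + n) = f k)"
    unfolding n_def by (rule LeastI[of _ "j - i"]) (rule ex)
  have least: "n \<le> m" if "0 < m" "f (k + m) = f k" for m k
    unfolding n_def by (rule Least_le) (use that in blast)
  from n obtain i where i: "f (i + n) = f i"
    by blast
  have ne: "f (i + a) \<noteq> f (i + b)" if "a < b" "b < n" for a b
    using least[of "b - a" "i + a"] that by auto
  have "inj_on (\<lambda>m. (\<phi> ^^ m) (f i)) {..<n}"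
    by (rule linorder_inj_onI) (use ne in \<open>auto simp: f_add\<close>)
  then show thesis
    using that[of "f i" n] n i fN by (simp add: f_add)
qed

context group
begin

text \<open>The conjugate of \<open>h\<close> by \<open>g\<close> stabilizes the translate.\<close>

lemma stabilizer_conj:
  assumes "A \<subseteq> carrier G" "g \<in> carrier G" "h \<in> carrier G" "h \<noteq> \<one>" "h <# A = A"
  shows "\<exists>k \<in> carrier G. k \<noteq> \<one> \<and> k <# (g <# A) = g <# A"
proof
  show "g \<otimes> h \<otimes> inv g \<in> carrier G"
    using assms by simp
  have "(g \<otimes> h \<otimes> inv g) \<otimes> g = g \<otimes> h"
    using assms by (simp add: m_assoc)
  then have "(g \<otimes> h \<otimes> inv g) <# (g <# A) = g <# (h <# A)"
    using assms(1-3) by (simp add: lcos_m_assoc)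
  then have "(g \<otimes> h \<otimes> inv g) <# (g <# A) = g <# A"
    using assms(5) by simp
  moreover have "g \<otimes> h \<otimes> inv g \<noteq> \<one>"
    using assms \<open>(g \<otimes> h \<otimes> inv g) \<otimes> g = g \<otimes> h\<close> l_cancel_one[of g h] by auto
  ultimately show "g \<otimes> h \<otimes> inv g \<noteq> \<one> \<and> (g \<otimes> h \<otimes> inv g) <# (g <# A) = g <# A"
    by simp
qed

end

section \<open>Weighted vertex sets without balanced cycles\<close>

locale unbalanced_weights = group G for G :: "('g, 'm) monoid_scheme" (structure) +
  fixes V :: "'v set" and w :: "'v \<Rightarrow> 'v \<Rightarrow> 'g"
  assumes finite_carrier: "finite (carrier G)"
    and odd_order: "odd (order G)"
    and finite_V: "finite V"
    and w_closed: "u \<in> V \<Longrightarrow> v \<in> V \<Longrightarrow> w u v \<in> carrier G"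
    and unbalanced: "distinct vs \<Longrightarrow> 2 \<le> length vs \<Longrightarrow> set vs \<subseteq> V \<Longrightarrow>
      walk_weight G w (vs @ [hd vs]) \<noteq> \<one>"
begin

lemma walk_weight_closed: "set vs \<subseteq> V \<Longrightarrow> walk_weight G w vs \<in> carrier G"
  by (induct vs rule: induct_list012) (auto intro: w_closed)

lemma walk_weight_snoc:
  "vs \<noteq> [] \<Longrightarrow> set vs \<subseteq> V \<Longrightarrow> x \<in> V \<Longrightarrow>
    walk_weight G w (vs @ [x]) = walk_weight G w vs \<otimes> w (last vs) x"
proof (induct vs rule: induct_list012)
  case (3 u v vs)
  have "walk_weight G w (v # vs) \<in> carrier G" "w (last (v # vs)) x \<in> carrier G"
    using 3 last_in_set[of "v # vs"] by (auto intro!: walk_weight_closed w_closed simp del: last.simps)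
  then show ?case
    using 3 w_closed[of u v] by (auto simp: m_assoc)
qed (auto simp: w_closed)

lemma path_weights_subset_carrier:
  assumes "T \<subseteq> V" "s \<in> T \<rightarrow> carrier G"
  shows "path_weights G w T s y \<subseteq> carrier G"
proof
  fix x assume "x \<in> path_weights G w T s y"
  then obtain vs where vs: "x = walk_weight G w vs \<otimes> s (last vs)" "vs \<noteq> []" "set vs \<subseteq> T"
    by (auto simp: path_weights_def)
  then have "last vs \<in> T"
    using last_in_set by blast
  then show "x \<in> carrier G"
    using vs assms by (auto intro!: walk_weight_closed)
qed

lemma path_weights_mono: "T' \<subseteq> T \<Longrightarrow> path_weights G w T' s y \<subseteq> path_weights G w T s y"
  unfolding path_weights_def by blast

text \<open>A path from \<open>v\<close> that avoids \<open>y\<close> can be preceded by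
  \<open>y\<close>.\<close>

lemma path_weights_step:
  assumes "T \<subseteq> V" "s \<in> T \<rightarrow> carrier G" "y \<in> T" "v \<in> T" "y \<noteq> v"
  shows "w y v <# path_weights G w (T - {y}) s v \<subseteq> path_weights G w T s y"
proof
  fix x assume "x \<in> w y v <# path_weights G w (T - {y}) s v"
  then obtain vs where vs: "x = w y v \<otimes> (walk_weight G w vs \<otimes> s (last vs))" "vs \<noteq> []"
      "hd vs = v" "distinct vs" "set vs \<subseteq> T - {y}"
    by (auto simp: path_weights_def l_coset_def)
  then have last: "last vs \<in> T"
    using last_in_set by blast
  obtain us where us: "vs = v # us"
    using vs by (cases vs) auto
  have "w y v \<in> carrier G" "walk_weight G w vs \<in> carrier G" "s (last vs) \<in> carrier G"
    using assms vs last by (auto intro!: w_closed walk_weight_closed)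
  then have "x = walk_weight G w (y # vs) \<otimes> s (last (y # vs))"
    using vs(1) us by (simp add: m_assoc)
  then show "x \<in> path_weights G w T s y"
    unfolding path_weights_def using vs assms by (intro CollectI exI[of _ "y # vs"]) auto
qed

lemma finite_path_weights:
  assumes "T \<subseteq> V" "s \<in> T \<rightarrow> carrier G"
  shows "finite (path_weights G w T s y)"
  using path_weights_subset_carrier[OF assms] finite_carrier finite_subset by blast

text \<open>Every element of this set is the weight of a cycle that leaves \<open>r\<close> for
  \<open>u\<close> and returns to \<open>r\<close> by the closing weight.\<close>

lemma one_notin_cycle_weights:
  assumes "r \<in> V" "u \<in> T" "T \<subseteq> V - {r}"
  shows "\<one> \<notin> w r u <# path_weights G w T (\<lambda>v. w v r) u"
proof
  assume "\<one> \<in> w r u <# path_weights G w T (\<lambda>v. w v r) u"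
  then obtain vs where vs: "w r u \<otimes> (walk_weight G w vs \<otimes> w (last vs) r) = \<one>" "vs \<noteq> []"
      "hd vs = u" "distinct vs" "set vs \<subseteq> T"
    by (auto simp: path_weights_def l_coset_def eq_commute[of \<one>])
  obtain us where us: "vs = u # us"
    using vs(2,3) by (cases vs) auto
  have "walk_weight G w ((r # vs) @ [hd (r # vs)]) = w r u \<otimes> walk_weight G w (vs @ [r])"
    by (simp add: us)
  also have "\<dots> = \<one>"
    using vs(1,2,5) assms by (subst walk_weight_snoc) auto
  finally have "walk_weight G w ((r # vs) @ [hd (r # vs)]) = \<one>" .
  moreover have "distinct (r # vs)" "2 \<le> length (r # vs)" "set (r # vs) \<subseteq> V"
    using us vs(4,5) assms by auto
  ultimately show False
    using unbalanced[of "r # vs"] by blast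
qed

text \<open>Strong induction with \<open>s\<close> arbitrary, since the hypothesis is needed both
  for \<open>s\<close> itself and for the closing weights \<open>w v r\<close>.\<close>

lemma exists_many_path_weights:
  assumes "T \<subseteq> V" "T \<noteq> {}" "s \<in> T \<rightarrow> carrier G"
  shows "\<exists>y\<in>T. card T \<le> card (path_weights G w T s y)"
  using assms
proof (induct "card T" arbitrary: T s rule: less_induct)
  case less
  note T = less.prems
  have finT: "finite T"
    using T(1) finite_V by (rule finite_subset)
  have IH: "\<exists>y\<in>T'. card T' \<le> card (path_weights G w T' s' y)"
    if "T' \<subset> T" "T' \<noteq> {}" "s' \<in> T' \<rightarrow> carrier G" for T' s'
    using less.hyps[OF psubset_card_mono[OF finT that(1)], of s'] that T(1) by blast
  define P where "P = path_weights G w T s"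
  have PG: "P y \<subseteq> carrier G" and finP: "finite (P y)" for y
    using path_weights_subset_carrier[OF T(1,3)] finite_path_weights[OF T(1,3)] by (auto simp: P_def)
  have wG: "w y v \<in> carrier G" if "y \<in> T" "v \<in> T" for y v
    using that T(1) w_closed by auto
  show ?case
  proof (rule ccontr)
    assume "\<not> ?case"
    then have small: "card (P y) < card T" if "y \<in> T" for y
      using that by (auto simp: P_def)
    \<comment> \<open>\<open>R y v\<close> collects the weights of those paths from \<open>v\<close>
      that can still be preceded by \<open>y\<close>.\<close>
    define R where "R = (\<lambda>y. path_weights G w (T - {y}) s)"
    have RG: "R y v \<subseteq> carrier G" and RP: "R y v \<subseteq> P v" for y v
      using path_weights_mono[of "T - {y}" T s v] PG[of v] by (auto simp: R_def P_def)
    have step: "w y v <# R y v \<subseteq> P y" if "y \<in> T" "v \<in> T" "y \<noteq> v" for y v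
      unfolding R_def P_def using T that by (intro path_weights_step) auto
    have ne: "T - {y} \<noteq> {}" if "y \<in> T" for y
    proof
      assume "T - {y} = {}"
      then have "T = {y}"
        using that by blast
      moreover have "s y \<in> P y"
        unfolding P_def path_weights_def using that T(3) by (intro CollectI exI[of _ "[y]"]) (auto simp: Pi_iff)
      then have "card (P y) \<ge> 1"
        using finP by (metis One_nat_def Suc_leI card_gt_0_iff empty_iff)
      ultimately show False
        using small[OF that] by simp
    qed
    have "\<exists>v. v \<in> T - {y} \<and> card T - 1 \<le> card (R y v)" if "y \<in> T" for y
      using IH[of "T - {y}" s] that ne[OF that] T finT by (auto simp: R_def)
    then obtain \<phi> where \<phi>: "\<And>y. y \<in> T \<Longrightarrow> \<phi> y \<in> T - {y}"
      and R\<phi>: "\<And>y. y \<in> T \<Longrightarrow> card T - 1 \<le> card (R y (\<phi> y))"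
      by metis
    \<comment> \<open>The translate of \<open>R y (\<phi> y)\<close> inside \<open>P y\<close> gives
      the lower bound, and \<open>small\<close> the upper one.\<close>
    have cardP: "card (P y) = card T - 1" if "y \<in> T" for y
    proof -
      have "card (w y (\<phi> y) <# R y (\<phi> y)) \<le> card (P y)"
        using \<phi>[OF that] that by (intro card_mono step finP) auto
      then show ?thesis
        using small[OF that] R\<phi>[OF that] wG[of y "\<phi> y"] \<phi>[OF that] that RG by (simp add: card_l_coset_eq)
    qed
    have full: "w y (\<phi> y) <# P (\<phi> y) = P y" if y: "y \<in> T" for y
    proof -
      have \<phi>y: "\<phi> y \<in> T" "y \<noteq> \<phi> y"
        using \<phi>[OF y] by auto
      have "R y (\<phi> y) = P (\<phi> y)"
        using R\<phi>[OF y] cardP[OF \<phi>y(1)] by (intro card_seteq finP RP) simp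
      then show ?thesis
        using step[OF y \<phi>y] card_l_coset_eq[OF PG wG[OF y \<phi>y(1)]] cardP[OF y] cardP[OF \<phi>y(1)]
        by (intro card_seteq finP) auto
    qed
    \<comment> \<open>The induction hypothesis on \<open>T\<close> without \<open>y\<close> and
      \<open>v\<close> supplies \<open>u\<close>; going from \<open>v\<close> to \<open>u\<close>
      first yields weights in \<open>R y v\<close>.\<close>
    have near: "card T \<le> card (R y v) + 2" if "y \<in> T" "v \<in> T" "y \<noteq> v" for y v
    proof (cases "T - {y} - {v} = {}")
      case True
      then have "T = {y, v}"
        using that by blast
      then show ?thesis
        using that by simp
    next
      case False
      let ?Q = "path_weights G w (T - {y} - {v}) s"
      obtain u where u: "u \<in> T - {y} - {v}" "card (T - {y} - {v}) \<le> card (?Q u)"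
        using IH[of "T - {y} - {v}" s] False \<open>y \<in> T\<close> T(3) by blast
      have "?Q u \<subseteq> carrier G"
        using T by (intro path_weights_subset_carrier) auto
      then have "card (?Q u) = card (w v u <# ?Q u)"
        using u that wG by (simp add: card_l_coset_eq)
      also have "\<dots> \<le> card (R y v)"
        unfolding R_def using T that u
        by (intro card_mono finite_path_weights path_weights_step) auto
      finally show ?thesis
        using u that finT by (simp add: card_Diff_singleton_if)
    qed
    have stab: "\<exists>h\<in>carrier G. h \<noteq> \<one> \<and> h <# P y = P y" if "y \<in> T" for y
    proof -
      \<comment> \<open>Vertices with trivial stabilizer. By \<open>full\<close> and conjugation,
        \<open>\<phi>\<close> maps \<open>N\<close> into itself, so a nonempty \<open>N\<close>
        would contain a cycle of \<open>\<phi>\<close>; its weight is not the identity and yet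
        stabilizes \<open>P x\<close>.\<close>
      define N where "N = {y \<in> T. \<forall>h\<in>carrier G. h <# P y = P y \<longrightarrow> h = \<one>}"
      have "\<phi> y \<in> N" if "y \<in> N" for y
      proof -
        have y: "y \<in> T" "\<phi> y \<in> T"
          using that \<phi> by (auto simp: N_def)
        show ?thesis
          using that y stabilizer_conj[OF PG[of "\<phi> y"] wG[OF y], unfolded full[OF y(1)]]
          unfolding N_def by blast
      qed
      then have N\<phi>: "\<phi> ` N \<subseteq> N"
        by blast
      \<comment> \<open>The equations \<open>full\<close> telescope along the orbit of
        \<open>\<phi>\<close>.\<close>
      have chain: "walk_weight G w (map (\<lambda>i. (\<phi> ^^ i) y) [0..<Suc n]) <# P ((\<phi> ^^ n) y) = P y"
        if "y \<in> T" for n y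
        using that
      proof (induct n arbitrary: y)
        case 0
        then show ?case
          using PG by (simp add: lcos_mult_one)
      next
        case (Suc n)
        let ?us = "map (\<lambda>i. (\<phi> ^^ i) (\<phi> y)) [0..<Suc n]"
        have iter: "(\<phi> ^^ i) x \<in> T" if "x \<in> T" for i x
          by (induct i) (use that \<phi> in auto)
        have \<phi>y: "\<phi> y \<in> T"
          using \<phi> Suc by auto
        have "map (\<lambda>i. (\<phi> ^^ i) y) [0..<Suc (Suc n)] = y # ?us"
          by (simp add: upt_conv_Cons map_Suc_upt[symmetric] funpow_swap1 del: upt_Suc)
        also have "?us = \<phi> y # tl ?us"
          by (simp add: upt_conv_Cons del: upt_Suc)
        finally have "walk_weight G w (map (\<lambda>i. (\<phi> ^^ i) y) [0..<Suc (Suc n)]) =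
            w y (\<phi> y) \<otimes> walk_weight G w ?us"
          using \<open>?us = \<phi> y # tl ?us\<close> by (metis walk_weight.simps(3))
        moreover have "set ?us \<subseteq> V"
          using iter[OF \<phi>y] T by auto
        ultimately show ?case
          using Suc.hyps[OF \<phi>y] full[OF Suc.prems] wG[OF Suc.prems \<phi>y] walk_weight_closed[of ?us]
            lcos_m_assoc[OF PG wG[OF Suc.prems \<phi>y] walk_weight_closed[of ?us], symmetric]
          by (simp add: funpow_swap1 del: upt_Suc)
      qed
      have "N = {}"
      proof (rule ccontr)
        assume "N \<noteq> {}"
        then obtain x\<^sub>0 where "x\<^sub>0 \<in> N"
          by blast
        then obtain x n where x: "x \<in> N" "0 < n" "(\<phi> ^^ n) x = x" "inj_on (\<lambda>i. (\<phi> ^^ i) x) {..<n}"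
          using funpow_cycle[of N x\<^sub>0 \<phi>] N\<phi> finT by (auto simp: N_def)
        let ?vs = "map (\<lambda>i. (\<phi> ^^ i) x) [0..<n]"
        have xT: "x \<in> T"
          using x by (simp add: N_def)
        \<comment> \<open>\<open>\<phi>\<close> has no fixed point, so its cycles are long enough
          for \<open>unbalanced\<close>.\<close>
        have "n \<noteq> 1"
          using x(3) \<phi>[OF xT] by auto
        then have len: "2 \<le> length ?vs"
          using x(2) by simp
        have "(\<phi> ^^ i) x \<in> T" for i
          by (induct i) (use xT \<phi> in auto)
        then have vsV: "set ?vs \<subseteq> V"
          using T by auto
        have "distinct ?vs"
          using x(4) by (simp add: distinct_map atLeast0LessThan)
        moreover have vs: "?vs @ [hd ?vs] = map (\<lambda>i. (\<phi> ^^ i) x) [0..<Suc n]"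
          using x(2,3) by (simp add: hd_map)
        ultimately have "walk_weight G w (map (\<lambda>i. (\<phi> ^^ i) x) [0..<Suc n]) \<noteq> \<one>"
          using unbalanced len vsV by metis
        moreover have "walk_weight G w (map (\<lambda>i. (\<phi> ^^ i) x) [0..<Suc n]) \<in> carrier G"
          unfolding vs[symmetric] using vsV len T(1) xT by (intro walk_weight_closed) (auto simp: hd_map)
        moreover have "walk_weight G w (map (\<lambda>i. (\<phi> ^^ i) x) [0..<Suc n]) <# P x = P x"
          using chain[OF xT, of n] x(3) by simp
        ultimately show False
          using x(1) by (auto simp: N_def)
      qed
      then show ?thesis
        using that by (auto simp: N_def)
    qed
    have all_full: "w y v <# P v = P y" if yv: "y \<in> T" "v \<in> T" "y \<noteq> v" for y v
    proof (rule ccontr)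
      assume neq: "w y v <# P v \<noteq> P y"
      let ?A = "w y v <# P v"
      have AG: "?A \<subseteq> carrier G" and finA: "finite ?A"
        using l_coset_subset_G[OF PG wG[OF yv(1,2)]] finite_carrier finite_subset by blast+
      have cardA: "card ?A = card T - 1"
        using card_l_coset_eq[OF PG wG[OF yv(1,2)]] cardP yv by simp
      have "w y v <# R y v \<subseteq> ?A \<inter> P y"
        using step[OF yv] RP[of y v] by (auto simp: l_coset_def)
      then have "card (R y v) \<le> card (?A \<inter> P y)"
        using card_mono[of "?A \<inter> P y" "w y v <# R y v"] finA card_l_coset_eq[OF RG wG[OF yv(1,2)]] by simp
      then have int: "card T \<le> card (?A \<inter> P y) + 2"
        using near[OF yv] by linarith
      have "\<not> P y \<subseteq> ?A"
        using neq card_subset_eq[OF finA, of "P y"] cardA cardP[OF yv(1)] by auto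
      then have "card (?A \<inter> P y) < card (P y)"
        by (intro psubset_card_mono finP) blast
      \<comment> \<open>Both sets have \<open>card T - 1\<close> elements and share at least
        \<open>card T - 2\<close>, but they differ; so exactly one element is exchanged.\<close>
      then have "card (?A - P y) = 1" "card (P y - ?A) = 1"
        using int cardP[OF yv(1)] cardA card_Diff_subset_Int[of ?A "P y"] card_Diff_subset_Int[of "P y" ?A] finA finP
        by (auto simp: Int_commute)
      then obtain a b where "?A - P y = {a}" "P y - ?A = {b}"
        by (auto simp: card_1_singleton_iff)
      moreover obtain h where "h \<in> carrier G" "h \<noteq> \<one>" "h <# P v = P v"
        using stab[OF yv(2)] by blast
      then obtain k where "k \<in> carrier G" "k \<noteq> \<one>" "k <# ?A = ?A"
        using stabilizer_conj[OF PG wG[OF yv(1,2)]] by blast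
      moreover obtain m where "m \<in> carrier G" "m \<noteq> \<one>" "m <# P y = P y"
        using stab[OF yv(1)] by blast
      ultimately show False
        using not_single_exchange[OF finite_carrier odd_order AG PG] by metis
    qed
    obtain r where r: "r \<in> T"
      using T(2) by blast
    let ?Z = "path_weights G w (T - {r}) (\<lambda>v. w v r)"
    obtain u where u: "u \<in> T - {r}" "card (T - {r}) \<le> card (?Z u)"
      using IH[of "T - {r}" "\<lambda>v. w v r"] ne[OF r] r wG by auto
    have ZG: "?Z u \<subseteq> carrier G"
      using T r wG by (intro path_weights_subset_carrier) auto
    let ?C = "w r u <# ?Z u"
    have wru: "w r u \<in> carrier G"
      using u r wG by auto
    have CG: "?C \<subseteq> carrier G"
      using l_coset_subset_G[OF ZG wru] .
    \<comment> \<open>\<open>all_full\<close> telescopes along any path in \<open>T\<close>;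
      distinctness keeps consecutive vertices apart.\<close>
    have walk: "walk_weight G w vs <# P (last vs) = P (hd vs)"
      if "vs \<noteq> []" "distinct vs" "set vs \<subseteq> T" for vs
      using that
    proof (induct vs rule: induct_list012)
      case (2 x)
      then show ?case
        using PG by (simp add: lcos_mult_one)
    next
      case (3 x y zs)
      have "set (y # zs) \<subseteq> V"
        using 3(5) T(1) by auto
      then have "walk_weight G w (y # zs) \<in> carrier G"
        by (rule walk_weight_closed)
      moreover have "w x y \<in> carrier G"
        using 3(5) wG by auto
      moreover have "walk_weight G w (y # zs) <# P (last (y # zs)) = P y"
        using 3 by simp
      moreover have "w x y <# P y = P x"
        using 3 by (intro all_full) auto
      ultimately show ?case
        using lcos_m_assoc[OF PG, of "w x y" "walk_weight G w (y # zs)" "last (y # zs)", symmetric] by simp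
    qed simp
    have "g <# P r = P r" if g: "g \<in> ?C" for g
    proof -
      obtain vs where vs: "g = w r u \<otimes> (walk_weight G w vs \<otimes> w (last vs) r)" "vs \<noteq> []"
        "hd vs = u" "distinct vs" "set vs \<subseteq> T - {r}"
        using g by (auto simp: path_weights_def l_coset_def)
      then have last: "last vs \<in> T - {r}"
        using last_in_set by blast
      have "set vs \<subseteq> V"
        using vs(5) T(1) by auto
      then have "walk_weight G w vs \<in> carrier G" "w (last vs) r \<in> carrier G"
        using wG r last by (auto intro: walk_weight_closed)
      then have "g <# P r = w r u <# (walk_weight G w vs <# (w (last vs) r <# P r))"
        using vs(1) wru PG by (simp add: lcos_m_assoc l_coset_subset_G)
      also have "w (last vs) r <# P r = P (last vs)"
        using last r by (intro all_full) auto
      also have "walk_weight G w vs <# P (last vs) = P u"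
        using walk[of vs] vs by auto
      also have "w r u <# P u = P r"
        using u r by (intro all_full) auto
      finally show ?thesis .
    qed
    moreover have "P r \<noteq> {}"
    proof
      assume "P r = {}"
      then have "card T - 1 = 0"
        using cardP[OF r] by simp
      then show False
        using ne[OF r] r finT by (metis card_Diff_singleton card_eq_0_iff finite_Diff)
    qed
    then obtain q where q: "q \<in> P r"
      by blast
    \<comment> \<open>All of \<open>?C\<close> stabilizes \<open>P r\<close>, so it maps
      \<open>q\<close> into \<open>P r\<close>. Equal cardinalities make \<open>?C #> q\<close> all
      of \<open>P r\<close>, and the element of \<open>?C\<close> that yields \<open>q\<close>
      itself is the identity.\<close>
    ultimately have sub: "?C #> q \<subseteq> P r"
      by (force simp: r_coset_def l_coset_def)
    have qG: "q \<in> carrier G"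
      using q PG by auto
    have "card (?C #> q) = card ?C"
    proof -
      have "?C #> q = (\<lambda>x. x \<otimes> q) ` ?C"
        by (auto simp: r_coset_def)
      moreover have "inj_on (\<lambda>x. x \<otimes> q) ?C"
        using CG qG by (auto simp: inj_on_def subset_iff)
      ultimately show ?thesis
        by (simp add: card_image)
    qed
    then have "?C #> q = P r"
      using sub u(2) cardP[OF r] card_l_coset_eq[OF ZG wru] finT r
      by (intro card_seteq finP) auto
    then obtain c where c: "c \<in> ?C" "q = c \<otimes> q"
      using q by (auto simp: r_coset_def)
    then have "c = \<one>"
      using CG qG by (metis r_cancel_one' subsetD)
    then show False
      using c(1) one_notin_cycle_weights[of r u "T - {r}"] u r T by auto
  qed
qed

text \<open>With more vertices, the weights of cycles through \<open>r\<close> would fill the whole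
  group and include the identity.\<close>

lemma card_V_le_order: "card V \<le> order G"
proof (rule ccontr)
  assume "\<not> card V \<le> order G"
  then have big: "order G < card V"
    by simp
  have "order G > 0"
    using finite_carrier by (simp add: order_gt_0_iff_finite)
  obtain r where r: "r \<in> V"
    using big by (metis card.empty ex_in_conv not_less_zero)
  then have card: "order G \<le> card (V - {r})"
    using big finite_V by simp
  let ?Z = "path_weights G w (V - {r}) (\<lambda>v. w v r)"
  have "V - {r} \<noteq> {}"
    using card \<open>order G > 0\<close> by (metis card.empty not_le)
  then obtain u where u: "u \<in> V - {r}" "card (V - {r}) \<le> card (?Z u)"
    using exists_many_path_weights[of "V - {r}" "\<lambda>v. w v r"] r w_closed by auto
  have ZG: "?Z u \<subseteq> carrier G"
    using r w_closed by (intro path_weights_subset_carrier) auto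
  have wru: "w r u \<in> carrier G"
    using u r w_closed by auto
  have "w r u <# ?Z u = carrier G"
    using l_coset_subset_G[OF ZG wru] card_l_coset_eq[OF ZG wru] u(2) card finite_carrier
    by (intro card_seteq) (auto simp: order_def)
  then show False
    using one_notin_cycle_weights[of r u "V - {r}"] u r by auto
qed

end

section \<open>Transfer from vertex lists to walks in the digraph\<close>

lemma awalk_of_vertices:
  assumes "wf_digraph D" "vs \<noteq> []" "set vs \<subseteq> verts D" "distinct_adj vs"
    and arc_of: "\<And>u v. u \<in> verts D \<Longrightarrow> v \<in> verts D \<Longrightarrow> u \<noteq> v \<Longrightarrow>
      arc_of u v \<in> arcs D \<and> tail D (arc_of u v) = u \<and> head D (arc_of u v) = v"
  defines "p \<equiv> map2 arc_of vs (tl vs)"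
  shows "pre_digraph.awalk D (hd vs) p (last vs)" "pre_digraph.awalk_verts D (hd vs) p = vs"
    and "label_product G l p = walk_weight G (\<lambda>u v. l (arc_of u v)) vs"
proof -
  interpret wf_digraph D by fact
  have "awalk (hd vs) (map2 arc_of vs (tl vs)) (last vs) \<and>
      awalk_verts (hd vs) (map2 arc_of vs (tl vs)) = vs \<and>
      label_product G l (map2 arc_of vs (tl vs)) = walk_weight G (\<lambda>u v. l (arc_of u v)) vs"
    using assms(2-4)
  proof (induct vs rule: induct_list012)
    case (3 u v vs)
    then show ?case
      using arc_of[of u v] by (auto simp: awalk_def label_product_def)
  qed (auto simp: awalk_def label_product_def)
  then show "awalk (hd vs) p (last vs)" "awalk_verts (hd vs) p = vs"
    "label_product G l p = walk_weight G (\<lambda>u v. l (arc_of u v)) vs"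
    by (simp_all add: p_def)
qed

theorem theorem1p1:
  fixes \<Gamma> :: "('g, 'm) monoid_scheme"
    and D :: "('v, 'e) pre_digraph"
    and l :: "'e \<Rightarrow> 'g"
  assumes "group \<Gamma>"
    and "finite (carrier \<Gamma>)"
    and "odd (order \<Gamma>)"
    and "complete_digraph (order \<Gamma> + 1) D"
    and "l \<in> labelling \<Gamma> D"
  shows "\<exists>p. balanced_cycle \<Gamma> D l p"
proof (rule ccontr)
  assume no_balanced: "\<nexists>p. balanced_cycle \<Gamma> D l p"
  interpret group \<Gamma> by fact
  interpret D: graph D
    using assms(4) by (simp add: complete_digraph_def)
  have card_verts: "card (verts D) = order \<Gamma> + 1"
    and ends: "arcs_ends D = {(u, v). (u, v) \<in> verts D \<times> verts D \<and> u \<noteq> v}"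
    using assms(4) by (simp_all add: complete_digraph_def)
  \<comment> \<open>For \<open>u = v\<close> an arbitrary arc serves as junk value, so that every weight lies in \<open>\<Gamma>\<close>.\<close>
  have "\<exists>e. e \<in> arcs D \<and> (u \<noteq> v \<longrightarrow> tail D e = u \<and> head D e = v)"
    if "u \<in> verts D" "v \<in> verts D" for u v
  proof -
    have arc: "\<exists>e. e \<in> arcs D \<and> tail D e = x \<and> head D e = y"
      if "x \<in> verts D" "y \<in> verts D" "x \<noteq> y" for x y
    proof -
      have "(x, y) \<in> arcs_ends D"
        using that by (simp add: ends)
      then show ?thesis
        by (auto simp: arcs_ends_conv)
    qed
    have "card (verts D) > 1"
      using assms(2) by (simp add: card_verts order_gt_0_iff_finite)
    then have "\<exists>x. x \<in> verts D \<and> x \<noteq> u"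
      using that(1) by (metis card_le_Suc0_iff_eq D.finite_verts One_nat_def not_le)
    then show ?thesis
      using arc that by metis
  qed
  then obtain arc_of where arc_of: "\<And>u v. u \<in> verts D \<Longrightarrow> v \<in> verts D \<Longrightarrow>
      arc_of u v \<in> arcs D \<and> (u \<noteq> v \<longrightarrow> tail D (arc_of u v) = u \<and> head D (arc_of u v) = v)"
    by metis
  interpret unbalanced_weights \<Gamma> "verts D" "\<lambda>u v. l (arc_of u v)"
  proof
    show "finite (carrier \<Gamma>)" "odd (order \<Gamma>)"
      using assms by auto
    show "l (arc_of u v) \<in> carrier \<Gamma>" if "u \<in> verts D" "v \<in> verts D" for u v
      using arc_of[OF that] assms(5) by (auto simp: labelling_def)
    fix vs :: "'v list"
    assume vs: "distinct vs" "2 \<le> length vs" "set vs \<subseteq> verts D"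
    then obtain x y zs where xyz: "vs = x # y # zs"
      by (cases vs; cases "tl vs") auto
    let ?us = "vs @ [hd vs]"
    let ?p = "map2 arc_of ?us (tl ?us)"
    \<comment> \<open>The closed list \<open>?us\<close> repeats its first vertex, so only
      neighbours in it can be required to differ.\<close>
    have "distinct_adj vs"
      using vs(1) by (simp add: distinct_adj_conv_nth nth_eq_iff_index_eq)
    moreover have "last vs \<noteq> hd vs"
      using vs(1) last_in_set[of "y # zs"] by (auto simp: xyz simp del: last_in_set)
    ultimately have us: "?us \<noteq> []" "set ?us \<subseteq> verts D" "distinct_adj ?us"
      using vs(3) hd_in_set[of vs] xyz[THEN arg_cong, of "\<lambda>xs. xs = []"]
      by (auto simp: distinct_adj_append_iff)
    note walk = awalk_of_vertices[OF D.wf_digraph us, of arc_of]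
    \<comment> \<open>The tail of \<open>?us\<close> is a rotation of \<open>vs\<close>, hence
      distinct, as the library's notion of cycle demands.\<close>
    have "D.cycle ?p"
      unfolding D.cycle_def using walk(1,2) arc_of vs xyz by (intro exI[of _ x]) auto
    moreover have "length ?p \<ge> 2"
      by (simp add: xyz)
    moreover have "\<not> balanced_cycle \<Gamma> D l ?p"
      using no_balanced by blast
    ultimately have "label_product \<Gamma> l ?p \<noteq> \<one>\<^bsub>\<Gamma>\<^esub>"
      by (auto simp: balanced_cycle_def)
    then show "walk_weight \<Gamma> (\<lambda>u v. l (arc_of u v)) ?us \<noteq> \<one>\<^bsub>\<Gamma>\<^esub>"
      using walk(3)[of \<Gamma> l] arc_of by auto
  qed (rule D.finite_verts)
  show False
    using card_V_le_order card_verts by simp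
qed

end
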